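(* Let $1<p<\infty$. Let $r_1,r_2\in\mathbb{C}$, let $s_1,s_2\in\mathbb{C}\setminus\{0\}$, and let $t_1,t_2\in\mathbb{C}$ be either both non-zero or both zero. Let $B=B(r_1,r_2;s_1,s_2;t_1,t_2)$ be the associated operator on $l_p$. Then the point spectrum of $B$ on $l_p$ is empty: $\sigma_p(B,l_p)=\emptyset$.
   Context: Sequences are indexed by $\mathbb{N}=\{1,2,3,\dots\}$, and $l_p$ is the complex Banach space of $p$-absolutely summable sequences. The operator $B=B(r_1,r_2;s_1,s_2;t_1,t_2)$ is given by the infinite lower triangular triple band matrix with period-two bands: with the convention $x_{-1}=x_0=0$, $(Bx)_n=t_1x_{n-2}+s_2x_{n-1}+r_1x_n$ for $n$ odd and $(Bx)_n=t_2x_{n-2}+s_1x_{n-1}+r_2x_n$ for $n$ even. The point spectrum $\sigma_p(T,X)$ of a bounded operator $T$ on $X$ is the set of $\lambda\in\mathbb{C}$ with $N(T-\lambda I)\ne\{0\}$, where $N$ denotes the null space. *)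

theory Defs
  imports Complex_Main
begin

text \<open>A sequence indexed by the positive integers is represented by a function
  \<^term>\<open>x :: nat \<Rightarrow> complex\<close> with \<^prop>\<open>x 0 = 0\<close>, so that the index 0 carries no information.\<close>

definition lp :: "real \<Rightarrow> (nat \<Rightarrow> complex) set" where
  "lp p = {x. x 0 = 0 \<and> summable (\<lambda>n. norm (x n) powr p)}"

definition lp_norm :: "real \<Rightarrow> (nat \<Rightarrow> complex) \<Rightarrow> real" where
  "lp_norm p x = (\<Sum>n. norm (x n) powr p) powr (1 / p)"

text \<open>The convention that the entries of x at -1 and 0 vanish needs no separate clause on \<^const>\<open>lp\<close>:
  at \<open>n = 1\<close> the truncated differences \<open>n - 2\<close> and \<open>n - 1\<close> are both 0, and \<^prop>\<open>x 0 = 0\<close>.\<close>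

definition band_op ::
  "complex \<Rightarrow> complex \<Rightarrow> complex \<Rightarrow> complex \<Rightarrow> complex \<Rightarrow> complex \<Rightarrow>
    (nat \<Rightarrow> complex) \<Rightarrow> (nat \<Rightarrow> complex)" where
  "band_op r1 r2 s1 s2 t1 t2 x n =
    (if n = 0 then 0
     else if odd n then t1 * x (n - 2) + s2 * x (n - 1) + r1 * x n
     else t2 * x (n - 2) + s1 * x (n - 1) + r2 * x n)"

definition null_space ::
  "(nat \<Rightarrow> complex) set \<Rightarrow> ((nat \<Rightarrow> complex) \<Rightarrow> (nat \<Rightarrow> complex)) \<Rightarrow> (nat \<Rightarrow> complex) set" where
  "null_space X T = {x \<in> X. T x = (\<lambda>n. 0)}"

definition point_spectrum ::
  "((nat \<Rightarrow> complex) \<Rightarrow> (nat \<Rightarrow> complex)) \<Rightarrow> (nat \<Rightarrow> complex) set \<Rightarrow> complex set" where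
  "point_spectrum T X = {l. null_space X (\<lambda>x n. T x n - l * x n) \<noteq> {\<lambda>n. 0}}"

text \<open>The remaining facts show that \<^const>\<open>band_op\<close> is a bounded linear operator on \<^const>\<open>lp\<close>.\<close>

lemma band_op_linear:
  "band_op r1 r2 s1 s2 t1 t2 (\<lambda>n. a * x n + b * y n) =
    (\<lambda>n. a * band_op r1 r2 s1 s2 t1 t2 x n + b * band_op r1 r2 s1 s2 t1 t2 y n)"
  by (rule ext) (simp add: band_op_def algebra_simps)

lemma norm_band_op_powr_le:
  assumes p: "1 < p"
    and M: "norm r1 \<le> M" "norm r2 \<le> M" "norm s1 \<le> M" "norm s2 \<le> M" "norm t1 \<le> M" "norm t2 \<le> M"
  shows "norm (band_op r1 r2 s1 s2 t1 t2 x n) powr p \<le>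
    (3 * M) powr p * (norm (x (n - 2)) powr p + norm (x (n - 1)) powr p + norm (x n) powr p)"
proof -
  have M0: "0 \<le> M" using M(1) norm_ge_zero order_trans by blast
  let ?a = "norm (x (n - 2))" and ?b = "norm (x (n - 1))" and ?c = "norm (x n)"
  let ?m = "max ?a (max ?b ?c)"
  have m0: "0 \<le> ?m" by (simp add: le_max_iff_disj)
  have aux: "norm (t * x (n - 2) + s * x (n - 1) + r * x n) \<le> 3 * M * ?m"
    if "norm t \<le> M" "norm s \<le> M" "norm r \<le> M" for t s r
  proof -
    have "norm (t * x (n - 2)) \<le> M * ?m" "norm (s * x (n - 1)) \<le> M * ?m" "norm (r * x n) \<le> M * ?m"
      using that M0 m0 unfolding norm_mult by (auto intro!: mult_mono)
    moreover have "norm (t * x (n - 2) + s * x (n - 1) + r * x n) \<le>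
        norm (t * x (n - 2)) + norm (s * x (n - 1)) + norm (r * x n)"
      by (meson norm_triangle_ineq norm_triangle_le add_mono order_refl)
    ultimately show ?thesis by linarith
  qed
  have "norm (band_op r1 r2 s1 s2 t1 t2 x n) \<le> 3 * M * ?m"
    unfolding band_op_def using aux M M0 m0 by simp
  then have "norm (band_op r1 r2 s1 s2 t1 t2 x n) powr p \<le> (3 * M * ?m) powr p"
    using p by (intro powr_mono2) auto
  also have "\<dots> = (3 * M) powr p * ?m powr p"
    using M0 m0 by (simp add: powr_mult)
  also have "\<dots> \<le> (3 * M) powr p * (?a powr p + ?b powr p + ?c powr p)"
    by (intro mult_left_mono) (auto simp: max_def)
  finally show ?thesis .
qed

lemma band_op_bounded_on_lp:
  assumes p: "1 < p"
  shows "\<exists>K. \<forall>x\<in>lp p. band_op r1 r2 s1 s2 t1 t2 x \<in> lp p \<and>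
    lp_norm p (band_op r1 r2 s1 s2 t1 t2 x) \<le> K * lp_norm p x"
proof -
  define M where "M = norm r1 + norm r2 + norm s1 + norm s2 + norm t1 + norm t2"
  have M: "norm r1 \<le> M" "norm r2 \<le> M" "norm s1 \<le> M" "norm s2 \<le> M" "norm t1 \<le> M" "norm t2 \<le> M"
    unfolding M_def by (auto intro: add_nonneg_nonneg add_increasing add_increasing2)
  define C where "C = (3 * M) powr p"
  have C0: "0 \<le> C" by (simp add: C_def)
  have "band_op r1 r2 s1 s2 t1 t2 x \<in> lp p \<and>
      lp_norm p (band_op r1 r2 s1 s2 t1 t2 x) \<le> (C * 3) powr (1 / p) * lp_norm p x"
    if "x \<in> lp p" for x
  proof -
    let ?B = "band_op r1 r2 s1 s2 t1 t2 x"
    let ?f = "\<lambda>n. norm (x n) powr p"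
    have x0: "x 0 = 0" and f: "summable ?f" using that by (auto simp: lp_def)
    have f1: "(\<lambda>n. ?f (n - 1)) sums suminf ?f"
      using sums_Suc[of "\<lambda>n. ?f (n - 1)" "suminf ?f"] f x0 by (simp add: summable_sums)
    have f2: "(\<lambda>n. ?f (n - 2)) sums suminf ?f"
      using sums_Suc[of "\<lambda>n. ?f (n - 2)" "suminf ?f"] f1 x0 by (simp add: numeral_2_eq_2)
    have g: "(\<lambda>n. C * (?f (n - 2) + ?f (n - 1) + ?f n)) sums (C * (suminf ?f + suminf ?f + suminf ?f))"
      by (intro sums_mult sums_add f1 f2 summable_sums f)
    have le: "norm (?B n) powr p \<le> C * (?f (n - 2) + ?f (n - 1) + ?f n)" for n
      unfolding C_def by (rule norm_band_op_powr_le[OF p M])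
    have S: "summable (\<lambda>n. norm (?B n) powr p)"
      by (rule summable_comparison_test'[OF sums_summable[OF g], of 0]) (use le in simp)
    have "(\<Sum>n. norm (?B n) powr p) \<le> C * 3 * suminf ?f"
      using suminf_le[OF le S sums_summable[OF g]] sums_unique[OF g] by (simp add: algebra_simps)
    then have "lp_norm p ?B \<le> (C * 3 * suminf ?f) powr (1 / p)"
      unfolding lp_norm_def using p by (intro powr_mono2 suminf_nonneg S) auto
    also have "\<dots> = (C * 3) powr (1 / p) * lp_norm p x"
      unfolding lp_norm_def using C0 suminf_nonneg[OF f] by (simp add: powr_mult)
    finally show ?thesis using S by (simp add: lp_def band_op_def)
  qed
  then show ?thesis by blast
qed

end

theory Submission
  imports Defs
begin

text \<open>The reason is purely algebraic. Suppose \<open>B x = l x\<close>, and let \<open>n\<close> be the first index with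
  \<open>x n \<noteq> 0\<close>. Row \<open>n\<close> of \<open>B - l I\<close> says that the diagonal entry of that row is zero. By periodicity
  the diagonal entries of the rows \<open>n + 2\<close> and \<open>n + 4\<close> vanish as well, so the four rows from \<open>n + 1\<close>
  to \<open>n + 4\<close> relate only the four entries from \<open>x n\<close> to \<open>x (n + 3)\<close>. These relations force
  \<open>x n = 0\<close>, a contradiction; this finite computation is \<open>leading_entry_zero\<close>. The two parities of
  \<open>n\<close> are exchanged by swapping the indices 1 and 2 of all coefficients.\<close>

text \<open>The entries \<open>y0, y1, \<dots>\<close> are those of an eigenvector from the first possibly non-zero one on,
  and the five equations are the corresponding rows, with diagonal entries \<open>a\<close> and \<open>b\<close>. If \<open>y0 \<noteq> 0\<close>,
  then \<open>a = 0\<close>. Eliminating \<open>y1\<close> between the second and the third row gives \<open>b * t = s * s'\<close>; hence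
  \<open>t\<close> and with it \<open>t'\<close> is non-zero. Because of this same identity, eliminating \<open>y3\<close> between the
  fourth and the fifth row also removes \<open>y2\<close> and leaves \<open>s' * t' * y1 = 0\<close>. So \<open>y1 = 0\<close>, and the
  second row becomes \<open>s * y0 = 0\<close>.\<close>

lemma leading_entry_zero:
  fixes a b s s' t t' y0 y1 y2 y3 y4 :: "'a::field"
  assumes s: "s \<noteq> 0" "s' \<noteq> 0"
    and t: "t \<noteq> 0 \<Longrightarrow> t' \<noteq> 0"
    and row0: "a * y0 = 0"
    and row1: "s * y0 + b * y1 = 0"
    and row2: "t * y0 + s' * y1 + a * y2 = 0"
    and row3: "t' * y1 + s * y2 + b * y3 = 0"
    and row4: "t * y2 + s' * y3 + a * y4 = 0"
  shows "y0 = 0"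
proof (rule ccontr)
  assume y0: "y0 \<noteq> 0"
  then have a: "a = 0" using row0 by simp
  have "(b * t - s * s') * y0 = b * (t * y0 + s' * y1) - s' * (s * y0 + b * y1)"
    by (simp add: algebra_simps)
  also have "\<dots> = 0" using row1 row2 a by simp
  finally have bt: "b * t = s * s'" using y0 by simp
  then have t': "t' \<noteq> 0" using s t by (metis mult_zero_right no_zero_divisors)
  have "s' * t' * y1 = (b * t - s * s') * y2 + s' * (t' * y1 + s * y2 + b * y3)
      - b * (t * y2 + s' * y3)"
    by (simp add: algebra_simps)
  also have "\<dots> = 0" using row3 row4 a bt by simp
  finally have "y1 = 0" using s t' by simp
  then show False using row1 s y0 by simp
qed

lemma band_op_eigenvector_zero:
  assumes s: "s1 \<noteq> 0" "s2 \<noteq> 0"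
    and t: "t1 = 0 \<longleftrightarrow> t2 = 0"
    and x0: "x 0 = 0"
    and eig: "\<And>n. band_op r1 r2 s1 s2 t1 t2 x n = l * x n"
  shows "x n = 0"
proof (induction n rule: less_induct)
  case (less n)
  show ?case
  proof (cases "n = 0")
    case True
    then show ?thesis using x0 by simp
  next
    case False
    \<comment> \<open>For \<open>n = 1\<close> the truncated \<open>n - 2\<close> is 0, which is still an index below \<open>n\<close>.\<close>
    then have prev: "x (n - 1) = 0" "x (n - 2) = 0" using less by auto
    have rows: "band_op r1 r2 s1 s2 t1 t2 x (n + k) - l * x (n + k) = 0" for k
      using eig by simp
    note rows = rows[of 0] rows[of 1] rows[of 2] rows[of 3] rows[of 4]
    have idx: "Suc n - 2 = n - 1" "n + 3 - 2 = n + 1" "n + 4 - 2 = n + 2"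
        "n + 3 - 1 = n + 2" "n + 4 - 1 = n + 3" "n + 1 = Suc n"
      using False by auto
    show ?thesis
    proof (cases "odd n")
      case True
      show ?thesis
        by (rule leading_entry_zero[of s1 s2 t1 t2 "r1 - l" "x n" "r2 - l" "x (n + 1)" "x (n + 2)"
              "x (n + 3)" "x (n + 4)"])
          (use s t True False prev rows in \<open>simp_all add: band_op_def idx algebra_simps\<close>)
    next
      case even: False
      show ?thesis
        by (rule leading_entry_zero[of s2 s1 t2 t1 "r2 - l" "x n" "r1 - l" "x (n + 1)" "x (n + 2)"
              "x (n + 3)" "x (n + 4)"])
          (use s t even False prev rows in \<open>simp_all add: band_op_def idx algebra_simps\<close>)
    qed
  qed
qed

theorem theorem3p3:
  fixes p :: real and r1 r2 s1 s2 t1 t2 :: complex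
  assumes "1 < p"
    and "s1 \<noteq> 0" and "s2 \<noteq> 0"
    and "(t1 \<noteq> 0 \<and> t2 \<noteq> 0) \<or> (t1 = 0 \<and> t2 = 0)"
  shows "point_spectrum (band_op r1 r2 s1 s2 t1 t2) (lp p) = {}"
proof -
  have "null_space (lp p) (\<lambda>x n. band_op r1 r2 s1 s2 t1 t2 x n - l * x n) = {\<lambda>n. 0}" for l
  proof
    show "null_space (lp p) (\<lambda>x n. band_op r1 r2 s1 s2 t1 t2 x n - l * x n) \<subseteq> {\<lambda>n. 0}"
    proof
      fix x assume "x \<in> null_space (lp p) (\<lambda>x n. band_op r1 r2 s1 s2 t1 t2 x n - l * x n)"
      then have x0: "x 0 = 0" and eig: "\<And>n. band_op r1 r2 s1 s2 t1 t2 x n = l * x n"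
        by (auto simp: null_space_def lp_def fun_eq_iff)
      have "x n = 0" for n
        by (rule band_op_eigenvector_zero[OF assms(2,3) _ x0 eig]) (use assms(4) in auto)
      then show "x \<in> {\<lambda>n. 0}" by auto
    qed
    show "{\<lambda>n. 0} \<subseteq> null_space (lp p) (\<lambda>x n. band_op r1 r2 s1 s2 t1 t2 x n - l * x n)"
      by (simp add: null_space_def lp_def band_op_def fun_eq_iff)
  qed
  then show ?thesis by (simp add: point_spectrum_def)
qed

end
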